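(* Let $n\in\mathbb{N}$, let $\rho>0$, let $f:\mathbb{R}^n\to\mathbb{R}$ be continuous, and let $X\subseteq\mathbb{R}^n$. For $x^*\in\mathbb{R}^n$ the following statements hold: (i) $x^*$ is a global minimum of (SPO) with penalty parameter $\rho$ if and only if there exists $y^*\in\mathbb{R}^n$ such that $(x^*,y^* )$ is a global minimum of (SPOlin). (ii) $x^*$ is a global minimum of (SPO) with penalty parameter $\frac{\rho}{2}$ if and only if there exists $y^*\in\mathbb{R}^n$ such that $(x^*,y^* )$ is a global minimum of (SPOsq). (Here (SPOlin) and (SPOsq) are taken with parameter $\rho$; the problems are defined in the context.)
   Context: For $x\in\mathbb{R}^n$, $\|x\|_0$ is the number of nonzero components of $x$; $e=(1,\dots,1)^T\in\mathbb{R}^n$; $x\circ y$ is the componentwise product; inequalities between vectors are componentwise. The problems are: (SPO) with penalty parameter $r>0$: $\min_{x} f(x)+r\|x\|_0$ subject to $x\in X$. (SPOlin): $\min_{(x,y)} f(x)+\rho(n-e^Ty)$ subject to $x\in X$, $x\circ y=0$, $y\le e$, with $(x,y)\in\mathbb{R}^n\times\mathbb{R}^n$. (SPOsq): $\min_{(x,y)} f(x)+\frac{\rho}{2}\sum_{i=1}^n y_i(y_i-2)$ subject to $x\in X$, $x\circ y=0$, with $(x,y)\in\mathbb{R}^n\times\mathbb{R}^n$. *)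

theory Defs
  imports "HOL-Analysis.Analysis"
begin

text \<open>
  \<^term>\<open>x \<bullet> y\<close> is the inner product, so \<open>1 \<bullet> y\<close> is \<open>e\<^sup>T y\<close> with \<open>e\<close> the all-ones vector;
  \<^term>\<open>x * y\<close> and \<open>x \<le> y\<close> on \<open>real ^ 'n\<close> are the componentwise product and order.
\<close>

definition l0_norm :: "real ^ 'n \<Rightarrow> nat"
  where "l0_norm x = card {i. x $ i \<noteq> 0}"

definition SPO_obj :: "(real ^ 'n \<Rightarrow> real) \<Rightarrow> real \<Rightarrow> real ^ 'n \<Rightarrow> real"
  where "SPO_obj f r x = f x + r * real (l0_norm x)"

definition SPOlin_obj :: "(real ^ 'n \<Rightarrow> real) \<Rightarrow> real \<Rightarrow> (real ^ 'n) \<times> (real ^ 'n) \<Rightarrow> real"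
  where "SPOlin_obj f \<rho> = (\<lambda>(x, y). f x + \<rho> * (real CARD('n) - 1 \<bullet> y))"

definition SPOlin_feasible :: "(real ^ 'n) set \<Rightarrow> ((real ^ 'n) \<times> (real ^ 'n)) set"
  where "SPOlin_feasible X = {(x, y). x \<in> X \<and> x * y = 0 \<and> y \<le> 1}"

definition SPOsq_obj :: "(real ^ 'n \<Rightarrow> real) \<Rightarrow> real \<Rightarrow> (real ^ 'n) \<times> (real ^ 'n) \<Rightarrow> real"
  where "SPOsq_obj f \<rho> = (\<lambda>(x, y). f x + \<rho> / 2 * (\<Sum>i\<in>UNIV. y $ i * (y $ i - 2)))"

definition SPOsq_feasible :: "(real ^ 'n) set \<Rightarrow> ((real ^ 'n) \<times> (real ^ 'n)) set"
  where "SPOsq_feasible X = {(x, y). x \<in> X \<and> x * y = 0}"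

definition global_min :: "('a \<Rightarrow> real) \<Rightarrow> 'a set \<Rightarrow> 'a \<Rightarrow> bool"
  where "global_min g S z \<longleftrightarrow> is_arg_min g (\<lambda>w. w \<in> S) z"

end

theory Submission
  imports Defs
begin

text \<open>
  Both relaxations reduce to the sparse problem by minimising over \<open>y\<close> for fixed \<open>x\<close>. The
  constraint \<open>x * y = 0\<close> forces \<open>y $ i = 0\<close> wherever \<open>x $ i \<noteq> 0\<close>; on the remaining components
  both the linear term \<open>1 - y $ i\<close> (under \<open>y $ i \<le> 1\<close>) and the quadratic term
  \<open>y $ i * (y $ i - 2) = (y $ i - 1)\<^sup>2 - 1\<close> are smallest at \<open>y $ i = 1\<close>. The minimal value over
  \<open>y\<close> is therefore attained at the indicator of the zero set of \<open>x\<close>, and it is the sparse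
  objective in the linear case, and the sparse objective with half the penalty parameter, shifted
  by the constant \<open>- \<rho> / 2 * CARD('n)\<close>, in the quadratic case. Lemma \<open>global_min_partial_iff\<close>
  says that minimising out \<open>y\<close> in this way does not change the set of minimising \<open>x\<close>.
\<close>

lemma global_min_iff: "global_min g S z \<longleftrightarrow> z \<in> S \<and> (\<forall>w\<in>S. g z \<le> g w)"
  unfolding global_min_def is_arg_min_def by (auto simp: not_less)

text \<open>
  Partial minimisation: if \<open>g + c\<close> bounds \<open>h\<close> from below on each fibre over \<open>X\<close> and the
  bound is attained at the selection \<open>w\<close>, then \<open>g\<close> and \<open>h\<close> have the same minimisers in the first
  component.
\<close>

lemma global_min_partial_iff:
  assumes lower: "\<And>x y. (x, y) \<in> F \<Longrightarrow> x \<in> X \<and> g x + c \<le> h (x, y)"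
    and attained: "\<And>x. x \<in> X \<Longrightarrow> (x, w x) \<in> F \<and> h (x, w x) = g x + c"
  shows "global_min g X x \<longleftrightarrow> (\<exists>y. global_min h F (x, y))"
proof
  assume gmin: "global_min g X x"
  then have x: "x \<in> X" and min: "\<And>x'. x' \<in> X \<Longrightarrow> g x \<le> g x'"
    by (auto simp: global_min_iff)
  have "h (x, w x) \<le> h (x', y')" if "(x', y') \<in> F" for x' y'
    using lower[OF that] attained[OF x] min[of x'] by linarith
  with attained[OF x] have "global_min h F (x, w x)"
    by (auto simp: global_min_iff)
  then show "\<exists>y. global_min h F (x, y)" ..
next
  assume "\<exists>y. global_min h F (x, y)"
  then obtain y where y: "(x, y) \<in> F" and min: "\<And>z. z \<in> F \<Longrightarrow> h (x, y) \<le> h z"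
    by (auto simp: global_min_iff)
  have "g x \<le> g x'" if "x' \<in> X" for x'
    using lower[OF y] attained[OF that] min[of "(x', w x')"] by linarith
  with lower[OF y] show "global_min g X x"
    by (auto simp: global_min_iff)
qed

text \<open>The indicator vector of the zero set of \<open>x\<close>; it is the best \<open>y\<close> for \<open>x\<close> in both relaxations.\<close>

definition zero_indicator :: "real ^ 'n \<Rightarrow> real ^ 'n"
  where "zero_indicator x = (\<chi> i. if x $ i = 0 then 1 else 0)"

lemma mult_zero_indicator: "x * zero_indicator x = 0"
  by (simp add: zero_indicator_def vec_eq_iff)

lemma zero_indicator_le_one: "zero_indicator x \<le> 1"
  by (simp add: zero_indicator_def less_eq_vec_def)

lemma sum_zero_indicator:
  "(\<Sum>i\<in>UNIV. zero_indicator x $ i) = real CARD('n) - real (l0_norm x)" for x :: "real ^ 'n"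
proof -
  have "(\<Sum>i\<in>UNIV. zero_indicator x $ i) = (\<Sum>i\<in>UNIV. 1 - of_bool (x $ i \<noteq> 0))"
    by (rule sum.cong) (auto simp: zero_indicator_def)
  also have "\<dots> = real CARD('n) - real (l0_norm x)"
    by (simp add: sum_subtractf l0_norm_def Collect_neg_eq)
  finally show ?thesis .
qed

lemma inner_one_vec: "1 \<bullet> y = (\<Sum>i\<in>UNIV. y $ i)" for y :: "real ^ 'n"
  by (simp add: inner_vec_def)

lemma mult_eq_zero_vec_nth:
  fixes x y :: "real ^ 'n"
  assumes "x * y = 0"
  shows "x $ i = 0 \<or> y $ i = 0"
proof -
  have "(x * y) $ i = 0"
    using assms by simp
  then show ?thesis
    by simp
qed

lemma inner_one_le_of_complementary:
  fixes x y :: "real ^ 'n"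
  assumes "x * y = 0" and "y \<le> 1"
  shows "1 \<bullet> y \<le> real CARD('n) - real (l0_norm x)"
proof -
  have "y $ i \<le> zero_indicator x $ i" for i
    using mult_eq_zero_vec_nth[OF assms(1), of i] assms(2)
    by (auto simp: zero_indicator_def less_eq_vec_def)
  then show ?thesis
    unfolding inner_one_vec sum_zero_indicator[symmetric] by (intro sum_mono)
qed

lemma sum_quadratic_ge_of_complementary:
  fixes x y :: "real ^ 'n"
  assumes "x * y = 0"
  shows "real (l0_norm x) - real CARD('n) \<le> (\<Sum>i\<in>UNIV. y $ i * (y $ i - 2))"
proof -
  have "- (zero_indicator x $ i) \<le> y $ i * (y $ i - 2)" for i
  proof -
    have "0 \<le> (y $ i - 1)\<^sup>2"
      by simp
    then have "- 1 \<le> y $ i * (y $ i - 2)"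
      by (simp add: power2_eq_square algebra_simps)
    then show ?thesis
      using mult_eq_zero_vec_nth[OF assms, of i] by (auto simp: zero_indicator_def)
  qed
  then have "(\<Sum>i\<in>UNIV. - (zero_indicator x $ i)) \<le> (\<Sum>i\<in>UNIV. y $ i * (y $ i - 2))"
    by (intro sum_mono)
  then show ?thesis
    by (simp add: sum_negf sum_zero_indicator)
qed

lemma sum_quadratic_zero_indicator:
  fixes x :: "real ^ 'n"
  shows "(\<Sum>i\<in>UNIV. zero_indicator x $ i * (zero_indicator x $ i - 2))
    = real (l0_norm x) - real CARD('n)"
proof -
  have "(\<Sum>i\<in>UNIV. zero_indicator x $ i * (zero_indicator x $ i - 2))
      = (\<Sum>i\<in>UNIV. - (zero_indicator x $ i))"
    by (rule sum.cong) (auto simp: zero_indicator_def)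
  then show ?thesis
    by (simp add: sum_negf sum_zero_indicator)
qed

lemma global_min_SPOlin_iff:
  fixes f :: "real ^ 'n \<Rightarrow> real"
  assumes "\<rho> \<ge> 0"
  shows "global_min (SPO_obj f \<rho>) X x
    \<longleftrightarrow> (\<exists>y. global_min (SPOlin_obj f \<rho>) (SPOlin_feasible X) (x, y))"
proof (rule global_min_partial_iff[where c = 0 and w = zero_indicator])
  fix x y :: "real ^ 'n"
  assume "(x, y) \<in> SPOlin_feasible X"
  then have x: "x \<in> X" and xy: "x * y = 0" "y \<le> 1"
    by (auto simp: SPOlin_feasible_def)
  have "\<rho> * real (l0_norm x) \<le> \<rho> * (real CARD('n) - 1 \<bullet> y)"
    using inner_one_le_of_complementary[OF xy] assms by (intro mult_left_mono) auto
  with x show "x \<in> X \<and> SPO_obj f \<rho> x + 0 \<le> SPOlin_obj f \<rho> (x, y)"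
    by (simp add: SPO_obj_def SPOlin_obj_def)
next
  fix x :: "real ^ 'n"
  assume "x \<in> X"
  then show "(x, zero_indicator x) \<in> SPOlin_feasible X
      \<and> SPOlin_obj f \<rho> (x, zero_indicator x) = SPO_obj f \<rho> x + 0"
    by (simp add: SPOlin_feasible_def SPO_obj_def SPOlin_obj_def mult_zero_indicator
        zero_indicator_le_one inner_one_vec sum_zero_indicator)
qed

lemma global_min_SPOsq_iff:
  fixes f :: "real ^ 'n \<Rightarrow> real"
  assumes "\<rho> \<ge> 0"
  shows "global_min (SPO_obj f (\<rho> / 2)) X x
    \<longleftrightarrow> (\<exists>y. global_min (SPOsq_obj f \<rho>) (SPOsq_feasible X) (x, y))"
proof (rule global_min_partial_iff[where c = "- (\<rho> / 2 * real CARD('n))" and w = zero_indicator])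
  fix x y :: "real ^ 'n"
  assume "(x, y) \<in> SPOsq_feasible X"
  then have x: "x \<in> X" and xy: "x * y = 0"
    by (auto simp: SPOsq_feasible_def)
  have "\<rho> / 2 * (real (l0_norm x) - real CARD('n)) \<le> \<rho> / 2 * (\<Sum>i\<in>UNIV. y $ i * (y $ i - 2))"
    using sum_quadratic_ge_of_complementary[OF xy] assms by (intro mult_left_mono) auto
  with x show "x \<in> X \<and> SPO_obj f (\<rho> / 2) x + - (\<rho> / 2 * real CARD('n)) \<le> SPOsq_obj f \<rho> (x, y)"
    by (simp add: SPO_obj_def SPOsq_obj_def right_diff_distrib)
next
  fix x :: "real ^ 'n"
  assume "x \<in> X"
  then show "(x, zero_indicator x) \<in> SPOsq_feasible X
      \<and> SPOsq_obj f \<rho> (x, zero_indicator x) = SPO_obj f (\<rho> / 2) x + - (\<rho> / 2 * real CARD('n))"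
    unfolding SPOsq_feasible_def SPO_obj_def SPOsq_obj_def
    by (simp only: prod.case sum_quadratic_zero_indicator)
      (simp add: mult_zero_indicator right_diff_distrib)
qed

theorem theorem3p5:
  fixes f :: "real ^ 'n \<Rightarrow> real" and X :: "(real ^ 'n) set"
    and \<rho> :: real and xs :: "real ^ 'n"
  assumes "\<rho> > 0" and "continuous_on UNIV f"
  shows "(global_min (SPO_obj f \<rho>) X xs \<longleftrightarrow>
            (\<exists>ys :: real ^ 'n. global_min (SPOlin_obj f \<rho>) (SPOlin_feasible X) (xs, ys)))
       \<and> (global_min (SPO_obj f (\<rho> / 2)) X xs \<longleftrightarrow>
            (\<exists>ys :: real ^ 'n. global_min (SPOsq_obj f \<rho>) (SPOsq_feasible X) (xs, ys)))"
  using assms(1) by (intro conjI global_min_SPOlin_iff global_min_SPOsq_iff) simp_all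

end
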